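(* Let $M$ be a smooth $3$-manifold and let $p\ge 1$. A cosymplectic $p$-sphere on $M$ is taut if and only if it is round.
   Context: A cosymplectic structure on a smooth manifold $M$ of dimension $2n+1$ is a pair $(\eta,\Omega)$ with $\eta$ a closed $1$-form and $\Omega$ a closed $2$-form such that $\eta\wedge\Omega^n$ is a volume form (nowhere zero). Its Reeb vector field $\xi$ is the unique vector field with $i_\xi\eta=1$, $i_\xi\Omega=0$. Cosymplectic structures $(\eta_1,\Omega_1),\ldots,(\eta_{p+1},\Omega_{p+1})$ on $M$, with Reeb vector fields $\xi_1,\ldots,\xi_{p+1}$, generate a cosymplectic $p$-sphere $\{(\eta_\lambda,\Omega_\lambda)\}_{\lambda\in\mathbb{S}^p}$ if for every $\lambda=(\lambda_1,\ldots,\lambda_{p+1})\in\mathbb{S}^p$ the pair $\eta_\lambda:=\sum_i\lambda_i\eta_i$, $\Omega_\lambda:=\sum_i\lambda_i\Omega_i$ is a cosymplectic structure on $M$. It is called taut if $\eta_\lambda\wedge\Omega_\lambda^n=\eta_{\lambda'}\wedge\Omega_{\lambda'}^n$ for all $\lambda,\lambda'\in\mathbb{S}^p$, and round if for every $\lambda\in\mathbb{S}^p$ the vector field $\sum_i\lambda_i\xi_i$ is the Reeb vector field of $(\eta_\lambda,\Omega_\lambda)$. (Here $\dim M=3$, so $n=1$.) *)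

theory Defs
  imports "HOL-Analysis.Analysis"
begin

section \<open>Smooth manifolds\<close>

primrec Ck_on :: "nat \<Rightarrow> 'e::euclidean_space set \<Rightarrow> ('e \<Rightarrow> 'f::euclidean_space) \<Rightarrow> bool" where
  "Ck_on 0 S f \<longleftrightarrow> continuous_on S f"
| "Ck_on (Suc k) S f \<longleftrightarrow>
     (\<forall>x\<in>S. f differentiable (at x)) \<and> (\<forall>v. Ck_on k S (\<lambda>x. frechet_derivative f (at x) v))"

text \<open>The notion of a $C^\infty$ map is only used for open \<open>S\<close>.\<close>

definition smooth_on :: "'e::euclidean_space set \<Rightarrow> ('e \<Rightarrow> 'f::euclidean_space) \<Rightarrow> bool" where
  "smooth_on S f \<longleftrightarrow> (\<forall>k. Ck_on k S f)"

text \<open>A chart \<open>(U, \<phi>)\<close> consists of its domain and its coordinate map; the values of \<open>\<phi>\<close>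
  outside \<open>U\<close> are irrelevant. The dimension of the manifold is \<open>CARD('n)\<close>.\<close>

type_synonym ('a, 'n) chart = "'a set \<times> ('a \<Rightarrow> real ^ 'n)"

record ('a, 'n) manifold =
  mtop :: "'a topology"
  atlas :: "('a, 'n) chart set"

abbreviation chart_image :: "('a, 'n::finite) chart \<Rightarrow> (real ^ 'n) set" where
  "chart_image c \<equiv> snd c ` fst c"

abbreviation chart_inv :: "('a, 'n::finite) chart \<Rightarrow> real ^ 'n \<Rightarrow> 'a" where
  "chart_inv c \<equiv> inv_into (fst c) (snd c)"

definition transition :: "('a, 'n::finite) chart \<Rightarrow> ('a, 'n) chart \<Rightarrow> real ^ 'n \<Rightarrow> real ^ 'n" where
  "transition c d = snd d \<circ> chart_inv c"

text \<open>The atlas need not be maximal: any smooth atlas determines the smooth structure, and the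
  notions below do not depend on the choice of an atlas for it.\<close>

definition smooth_manifold :: "('a, 'n::finite) manifold \<Rightarrow> bool" where
  "smooth_manifold M \<longleftrightarrow>
     Hausdorff_space (mtop M) \<and> second_countable (mtop M) \<and>
     (\<Union>c\<in>atlas M. fst c) = topspace (mtop M) \<and>
     (\<forall>c\<in>atlas M. openin (mtop M) (fst c) \<and> open (chart_image c) \<and>
        homeomorphic_map (subtopology (mtop M) (fst c)) (top_of_set (chart_image c)) (snd c)) \<and>
     (\<forall>c\<in>atlas M. \<forall>d\<in>atlas M. smooth_on (snd c ` (fst c \<inter> fst d)) (transition c d))"


section \<open>Tangent vectors and vector fields\<close>

text \<open>A tangent vector at \<open>x\<close> is given by its components with respect to all the charts around
  \<open>x\<close>, subject to the transformation law under changes of coordinates. The value at a chart that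
  does not contain \<open>x\<close> is set to 0, so the vector space operations are pointwise. For \<open>x\<close> outside
  the manifold the tangent space consists of the zero vector only.\<close>

type_synonym ('a, 'n) tvec = "('a, 'n) chart \<Rightarrow> real ^ 'n"

definition tangent_space :: "('a, 'n::finite) manifold \<Rightarrow> 'a \<Rightarrow> ('a, 'n) tvec set" where
  "tangent_space M x =
     {v. (\<forall>c\<in>atlas M. \<forall>d\<in>atlas M. x \<in> fst c \<and> x \<in> fst d \<longrightarrow>
            v d = frechet_derivative (transition c d) (at (snd c x)) (v c)) \<and>
         (\<forall>c. c \<notin> atlas M \<or> x \<notin> fst c \<longrightarrow> v c = 0)}"

text \<open>The tangent vector at \<open>x\<close> whose component in the chart \<open>c\<close> around \<open>x\<close> is \<open>u\<close>.\<close>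

definition coord_vec ::
    "('a, 'n::finite) manifold \<Rightarrow> ('a, 'n) chart \<Rightarrow> 'a \<Rightarrow> real ^ 'n \<Rightarrow> ('a, 'n) tvec" where
  "coord_vec M c x u =
     (\<lambda>d. if d \<in> atlas M \<and> x \<in> fst d
          then frechet_derivative (transition c d) (at (snd c x)) u else 0)"

definition vector_field ::
    "('a, 'n::finite) manifold \<Rightarrow> ('a \<Rightarrow> ('a, 'n) tvec) \<Rightarrow> bool" where
  "vector_field M \<xi> \<longleftrightarrow>
     (\<forall>x. \<xi> x \<in> tangent_space M x) \<and>
     (\<forall>c\<in>atlas M. smooth_on (chart_image c) (\<lambda>y. \<xi> (chart_inv c y) c))"


section \<open>Differential forms\<close>

text \<open>A \<open>k\<close>-form assigns to a point and a list of \<open>k\<close> tangent vectors at that point a real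
  number; its values on other arguments are irrelevant.\<close>

type_synonym ('a, 'n) form = "'a \<Rightarrow> ('a, 'n) tvec list \<Rightarrow> real"

definition tangent_tuples ::
    "('a, 'n::finite) manifold \<Rightarrow> nat \<Rightarrow> 'a \<Rightarrow> ('a, 'n) tvec list set" where
  "tangent_tuples M k x = {vs. length vs = k \<and> set vs \<subseteq> tangent_space M x}"

definition alternating_at ::
    "('a, 'n::finite) manifold \<Rightarrow> nat \<Rightarrow> 'a \<Rightarrow> (('a, 'n) tvec list \<Rightarrow> real) \<Rightarrow> bool" where
  "alternating_at M k x f \<longleftrightarrow>
     (\<forall>vs\<in>tangent_tuples M k x. \<forall>i<k.
        (\<forall>u\<in>tangent_space M x. \<forall>w\<in>tangent_space M x. \<forall>a b.
           f (vs[i := (\<lambda>c. a *\<^sub>R u c + b *\<^sub>R w c)]) = a * f (vs[i := u]) + b * f (vs[i := w])) \<and>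
        (\<forall>j<k. i \<noteq> j \<and> vs ! i = vs ! j \<longrightarrow> f vs = 0))"

text \<open>The local expression of a form in the chart \<open>c\<close>.\<close>

definition local_rep ::
    "('a, 'n::finite) manifold \<Rightarrow> ('a, 'n) chart \<Rightarrow> ('a, 'n) form \<Rightarrow> real ^ 'n \<Rightarrow> (real ^ 'n) list \<Rightarrow> real"
    where
  "local_rep M c \<omega> y us = \<omega> (chart_inv c y) (map (coord_vec M c (chart_inv c y)) us)"

definition differential_form ::
    "('a, 'n::finite) manifold \<Rightarrow> nat \<Rightarrow> ('a, 'n) form \<Rightarrow> bool" where
  "differential_form M k \<omega> \<longleftrightarrow>
     (\<forall>x\<in>topspace (mtop M). alternating_at M k x (\<omega> x)) \<and>
     (\<forall>c\<in>atlas M. \<forall>us. length us = k \<longrightarrow> smooth_on (chart_image c) (\<lambda>y. local_rep M c \<omega> y us))"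

text \<open>The exterior derivative of a \<open>k\<close>-form on an open subset of a Euclidean space, evaluated on
  \<open>k + 1\<close> constant vector fields.\<close>

definition ext_deriv ::
    "nat \<Rightarrow> ('e::euclidean_space \<Rightarrow> 'e list \<Rightarrow> real) \<Rightarrow> 'e \<Rightarrow> 'e list \<Rightarrow> real" where
  "ext_deriv k f y us =
     (\<Sum>i\<le>k. (- 1) ^ i *
        frechet_derivative (\<lambda>z. f z (take i us @ drop (Suc i) us)) (at y) (us ! i))"

definition closed_form :: "('a, 'n::finite) manifold \<Rightarrow> nat \<Rightarrow> ('a, 'n) form \<Rightarrow> bool" where
  "closed_form M k \<omega> \<longleftrightarrow>
     differential_form M k \<omega> \<and>
     (\<forall>c\<in>atlas M. \<forall>y\<in>chart_image c. \<forall>us. length us = Suc k \<longrightarrow>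
        ext_deriv k (local_rep M c \<omega>) y us = 0)"

text \<open>The normalisation is such that \<open>\<alpha> \<and> \<beta>\<close> is the sum over all shuffles.\<close>

definition wedge :: "nat \<Rightarrow> nat \<Rightarrow> ('a, 'n) form \<Rightarrow> ('a, 'n) form \<Rightarrow> ('a, 'n) form" where
  "wedge k l \<alpha> \<beta> = (\<lambda>x vs.
     (\<Sum>\<sigma> | \<sigma> permutes {..<k + l}.
        of_int (sign \<sigma>) * \<alpha> x (map (\<lambda>i. vs ! \<sigma> i) [0..<k])
                        * \<beta> x (map (\<lambda>i. vs ! \<sigma> i) [k..<k + l])) / (fact k * fact l))"

text \<open>The \<open>m\<close>-fold wedge power of a \<open>k\<close>-form, a form of degree \<open>k * m\<close>.\<close>

primrec wedge_power :: "nat \<Rightarrow> ('a, 'n) form \<Rightarrow> nat \<Rightarrow> ('a, 'n) form" where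
  "wedge_power k \<omega> 0 = (\<lambda>x vs. 1)"
| "wedge_power k \<omega> (Suc m) = wedge k (k * m) \<omega> (wedge_power k \<omega> m)"

definition interior_product ::
    "('a \<Rightarrow> ('a, 'n) tvec) \<Rightarrow> ('a, 'n) form \<Rightarrow> ('a, 'n) form" where
  "interior_product \<xi> \<omega> = (\<lambda>x vs. \<omega> x (\<xi> x # vs))"

definition form_eq ::
    "('a, 'n::finite) manifold \<Rightarrow> nat \<Rightarrow> ('a, 'n) form \<Rightarrow> ('a, 'n) form \<Rightarrow> bool" where
  "form_eq M k \<alpha> \<beta> \<longleftrightarrow>
     (\<forall>x\<in>topspace (mtop M). \<forall>vs\<in>tangent_tuples M k x. \<alpha> x vs = \<beta> x vs)"

definition nowhere_zero :: "('a, 'n::finite) manifold \<Rightarrow> nat \<Rightarrow> ('a, 'n) form \<Rightarrow> bool" where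
  "nowhere_zero M k \<omega> \<longleftrightarrow>
     (\<forall>x\<in>topspace (mtop M). \<exists>vs\<in>tangent_tuples M k x. \<omega> x vs \<noteq> 0)"


section \<open>Cosymplectic structures\<close>

text \<open>The top-degree form \<open>\<eta> \<and> \<Omega>^n\<close>.\<close>

definition cosymplectic_volume ::
    "nat \<Rightarrow> ('a, 'n) form \<Rightarrow> ('a, 'n) form \<Rightarrow> ('a, 'n) form" where
  "cosymplectic_volume n \<eta> \<Omega> = wedge 1 (2 * n) \<eta> (wedge_power 2 \<Omega> n)"

definition cosymplectic ::
    "nat \<Rightarrow> ('a, 'n::finite) manifold \<Rightarrow> ('a, 'n) form \<Rightarrow> ('a, 'n) form \<Rightarrow> bool" where
  "cosymplectic n M \<eta> \<Omega> \<longleftrightarrow>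
     CARD('n) = 2 * n + 1 \<and> closed_form M 1 \<eta> \<and> closed_form M 2 \<Omega> \<and>
     nowhere_zero M (2 * n + 1) (cosymplectic_volume n \<eta> \<Omega>)"

definition is_reeb ::
    "('a, 'n::finite) manifold \<Rightarrow> ('a, 'n) form \<Rightarrow> ('a, 'n) form \<Rightarrow> ('a \<Rightarrow> ('a, 'n) tvec) \<Rightarrow> bool"
    where
  "is_reeb M \<eta> \<Omega> \<xi> \<longleftrightarrow>
     vector_field M \<xi> \<and>
     form_eq M 0 (interior_product \<xi> \<eta>) (\<lambda>x vs. 1) \<and>
     form_eq M 1 (interior_product \<xi> \<Omega>) (\<lambda>x vs. 0)"

definition reeb ::
    "('a, 'n::finite) manifold \<Rightarrow> ('a, 'n) form \<Rightarrow> ('a, 'n) form \<Rightarrow> 'a \<Rightarrow> ('a, 'n) tvec" where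
  "reeb M \<eta> \<Omega> = (THE \<xi>. is_reeb M \<eta> \<Omega> \<xi>)"


section \<open>Cosymplectic spheres\<close>

text \<open>The \<open>p + 1\<close> generators are indexed by \<open>0, \<dots>, p\<close>, as are the coordinates of the points of
  the unit sphere \<^term>\<open>nsphere p\<close> in Euclidean \<open>(p + 1)\<close>-space.\<close>

definition comb_form ::
    "nat \<Rightarrow> (nat \<Rightarrow> real) \<Rightarrow> (nat \<Rightarrow> ('a, 'n) form) \<Rightarrow> ('a, 'n) form" where
  "comb_form p l \<omega> = (\<lambda>x vs. \<Sum>i\<le>p. l i * \<omega> i x vs)"

definition comb_field ::
    "nat \<Rightarrow> (nat \<Rightarrow> real) \<Rightarrow> (nat \<Rightarrow> 'a \<Rightarrow> ('a, 'n::finite) tvec) \<Rightarrow> 'a \<Rightarrow> ('a, 'n) tvec" where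
  "comb_field p l \<xi> = (\<lambda>x c. \<Sum>i\<le>p. l i *\<^sub>R \<xi> i x c)"

definition cosymplectic_sphere ::
    "nat \<Rightarrow> ('a, 'n::finite) manifold \<Rightarrow> nat \<Rightarrow> (nat \<Rightarrow> ('a, 'n) form) \<Rightarrow> (nat \<Rightarrow> ('a, 'n) form) \<Rightarrow> bool"
    where
  "cosymplectic_sphere n M p \<eta> \<Omega> \<longleftrightarrow>
     (\<forall>i\<le>p. cosymplectic n M (\<eta> i) (\<Omega> i)) \<and>
     (\<forall>l\<in>topspace (nsphere p). cosymplectic n M (comb_form p l \<eta>) (comb_form p l \<Omega>))"

definition taut ::
    "nat \<Rightarrow> ('a, 'n::finite) manifold \<Rightarrow> nat \<Rightarrow> (nat \<Rightarrow> ('a, 'n) form) \<Rightarrow> (nat \<Rightarrow> ('a, 'n) form) \<Rightarrow> bool"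
    where
  "taut n M p \<eta> \<Omega> \<longleftrightarrow>
     (\<forall>l\<in>topspace (nsphere p). \<forall>\<mu>\<in>topspace (nsphere p).
        form_eq M (2 * n + 1)
          (cosymplectic_volume n (comb_form p l \<eta>) (comb_form p l \<Omega>))
          (cosymplectic_volume n (comb_form p \<mu> \<eta>) (comb_form p \<mu> \<Omega>)))"

definition round_sphere ::
    "('a, 'n::finite) manifold \<Rightarrow> nat \<Rightarrow> (nat \<Rightarrow> ('a, 'n) form) \<Rightarrow> (nat \<Rightarrow> ('a, 'n) form) \<Rightarrow> bool"
    where
  "round_sphere M p \<eta> \<Omega> \<longleftrightarrow>
     (\<forall>l\<in>topspace (nsphere p).
        is_reeb M (comb_form p l \<eta>) (comb_form p l \<Omega>)
          (comb_field p l (\<lambda>i. reeb M (\<eta> i) (\<Omega> i))))"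

end

theory Submission
  imports Defs
begin

text \<open>In a chart, \<open>\<eta>\<close> is the inner product with a vector \<open>h\<close>, and \<open>\<Omega>\<close> is the contraction of the standard
  volume form with a vector \<open>X\<close>. Then \<open>\<eta> \<and> \<Omega>\<close> is \<open>h \<bullet> X\<close> times the volume form, and the Reeb vector is
  \<open>X / (h \<bullet> X)\<close>. Both \<open>h\<close> and \<open>X\<close> are linear in \<open>\<lambda>\<close>, and \<open>X \<noteq> 0\<close> on the sphere, so the generators
  \<open>X i\<close> are linearly independent. Hence roundness, which reads
  \<open>\<Sum>i. \<lambda> i X i / (h i \<bullet> X i) = (\<Sum>i. \<lambda> i X i) / (h \<lambda> \<bullet> X \<lambda>)\<close>, says exactly that \<open>h \<lambda> \<bullet> X \<lambda>\<close> does not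
  depend on \<open>\<lambda>\<close>.\<close>

section \<open>Calculus of smooth maps\<close>

text \<open>Since \<open>S\<close> is open, \<open>f\<close> and \<open>g\<close> agree near each of
  its points, so the derivatives agree on \<open>S\<close> as well and the induction can continue
  with them.\<close>

lemma Ck_on_cong:
  assumes "open S" "\<And>x. x \<in> S \<Longrightarrow> f x = g x" "Ck_on k S f"
  shows "Ck_on k S g"
  using assms(2,3)
proof (induction k arbitrary: f g)
  case 0
  then show ?case by (simp add: continuous_on_eq)
next
  case (Suc k)
  have fd: "(f has_derivative frechet_derivative f (at x)) (at x)" if "x \<in> S" for x
    using Suc.prems(2) that by (simp add: frechet_derivative_works)
  have gd: "(g has_derivative frechet_derivative f (at x)) (at x)" if "x \<in> S" for x
    by (rule has_derivative_transform_within_open[OF fd[OF that] assms(1) that Suc.prems(1)])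
  have "Ck_on k S (\<lambda>x. frechet_derivative g (at x) v)" for v
  proof (rule Suc.IH)
    show "Ck_on k S (\<lambda>x. frechet_derivative f (at x) v)" using Suc.prems(2) by simp
    show "frechet_derivative f (at x) v = frechet_derivative g (at x) v" if "x \<in> S" for x
      using frechet_derivative_at[OF gd[OF that]] by simp
  qed
  then show ?case using gd by (auto simp: differentiable_def)
qed

text \<open>By uniqueness of derivatives any formula for the derivative may stand in for
  \<open>frechet_derivative\<close>. The closure properties below feed the usual differentiation
  rules into this.\<close>

lemma Ck_on_SucI:
  assumes "open S" "\<And>x. x \<in> S \<Longrightarrow> (f has_derivative f' x) (at x)"
    and "\<And>v. Ck_on k S (\<lambda>x. f' x v)"
  shows "Ck_on (Suc k) S f"
proof -
  have "Ck_on k S (\<lambda>x. frechet_derivative f (at x) v)" for v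
    by (rule Ck_on_cong[OF assms(1) _ assms(3)]) (use frechet_derivative_at[OF assms(2)] in simp)
  then show ?thesis using assms(2) by (auto simp: differentiable_def)
qed

lemma Ck_on_SucD:
  assumes "Ck_on (Suc k) S f" shows "Ck_on k S f"
  using assms
proof (induction k arbitrary: f)
  case 0
  then show ?case
    by (auto intro!: continuous_at_imp_continuous_on differentiable_imp_continuous_within)
next
  case (Suc k)
  then show ?case by simp
qed

lemma Ck_on_Suc_has_derivative:
  assumes "Ck_on (Suc k) S f" "x \<in> S"
  shows "(f has_derivative frechet_derivative f (at x)) (at x)"
  using assms by (simp add: frechet_derivative_works)

lemma Ck_on_const: "Ck_on k S (\<lambda>x. c)"
proof (induction k arbitrary: c)
  case (Suc k)
  then show ?case by (simp add: frechet_derivative_const)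
qed simp

lemma Ck_on_bounded_linear:
  assumes "bounded_linear L" "open S" "Ck_on k S f"
  shows "Ck_on k S (\<lambda>x. L (f x))"
  using assms(3)
proof (induction k arbitrary: f)
  case 0
  then show ?case using bounded_linear.continuous_on[OF assms(1)] by auto
next
  case (Suc k)
  show ?case
    by (rule Ck_on_SucI[OF assms(2)
          bounded_linear.has_derivative[OF assms(1) Ck_on_Suc_has_derivative[OF Suc.prems]]])
       (use Suc in auto)
qed

lemma Ck_on_add:
  assumes "open S" "Ck_on k S f" "Ck_on k S g"
  shows "Ck_on k S (\<lambda>x. f x + g x)"
  using assms(2,3)
proof (induction k arbitrary: f g)
  case 0
  then show ?case by (auto intro: continuous_on_add)
next
  case (Suc k)
  show ?case
    by (rule Ck_on_SucI[OF assms(1)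
          has_derivative_add[OF Ck_on_Suc_has_derivative[OF Suc.prems(1)]
            Ck_on_Suc_has_derivative[OF Suc.prems(2)]]])
       (use Suc in auto)
qed

lemma Ck_on_sum:
  assumes "open S" "\<And>i. i \<in> I \<Longrightarrow> Ck_on k S (f i)"
  shows "Ck_on k S (\<lambda>x. \<Sum>i\<in>I. f i x)"
  using assms(2)
  by (induction I rule: infinite_finite_induct) (auto intro: Ck_on_add[OF assms(1)] Ck_on_const)

text \<open>The product rule leaves \<open>f\<close> and \<open>g\<close> themselves in the
  derivative, next to \<open>f'\<close> and \<open>g'\<close>. The induction step therefore lowers
  their order by one with \<open>Ck_on_SucD\<close>.\<close>

lemma Ck_on_bounded_bilinear:
  assumes "bounded_bilinear b" "open S" "Ck_on k S f" "Ck_on k S g"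
  shows "Ck_on k S (\<lambda>x. b (f x) (g x))"
  using assms(3,4)
proof (induction k arbitrary: f g)
  case 0
  then show ?case using bounded_bilinear.continuous_on[OF assms(1)] by auto
next
  case (Suc k)
  have "Ck_on k S f" "Ck_on k S g" using Suc.prems by (blast intro: Ck_on_SucD)+
  then show ?case
    by (intro Ck_on_SucI[OF assms(2)
          bounded_bilinear.FDERIV[OF assms(1) Ck_on_Suc_has_derivative[OF Suc.prems(1)]
            Ck_on_Suc_has_derivative[OF Suc.prems(2)]]])
       (use Suc in \<open>auto intro: Ck_on_add[OF assms(2)]\<close>)
qed

lemma Ck_on_inverse:
  fixes f :: "'e::euclidean_space \<Rightarrow> real"
  assumes "open S" "\<And>x. x \<in> S \<Longrightarrow> f x \<noteq> 0" "Ck_on k S f"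
  shows "Ck_on k S (\<lambda>x. inverse (f x))"
  using assms(3)
proof (induction k)
  case 0
  then show ?case using assms(2) by (auto intro: continuous_on_inverse)
next
  case (Suc k)
  note mult = Ck_on_bounded_bilinear[OF bounded_bilinear_mult assms(1)]
  have inv: "Ck_on k S (\<lambda>x. inverse (f x))" using Suc.IH Suc.prems by (blast intro: Ck_on_SucD)
  have "Ck_on k S (\<lambda>x. - (inverse (f x) * frechet_derivative f (at x) v * inverse (f x)))" for v
    using Suc.prems
    by (intro Ck_on_bounded_linear[OF bounded_linear_minus[OF bounded_linear_ident] assms(1)] mult inv)
      simp
  then show ?case
    by (intro Ck_on_SucI[OF assms(1) Deriv.has_derivative_inverse[OF assms(2)
            Ck_on_Suc_has_derivative[OF Suc.prems]]]) auto
qed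

lemma Ck_on_vecI:
  fixes f :: "'e::euclidean_space \<Rightarrow> real ^ 'n"
  assumes "open S" "\<And>i. Ck_on k S (\<lambda>x. f x $ i)"
  shows "Ck_on k S f"
proof -
  have "f = (\<lambda>x. \<Sum>i\<in>UNIV. f x $ i *\<^sub>R axis i 1)"
    by (simp add: fun_eq_iff vec_eq_iff axis_def if_distrib cong: if_cong)
  moreover have "Ck_on k S (\<lambda>x. \<Sum>i\<in>UNIV. f x $ i *\<^sub>R axis i (1::real))"
    by (intro Ck_on_sum assms Ck_on_bounded_linear[OF bounded_linear_scaleR_left])
  ultimately show ?thesis by simp
qed


section \<open>Tangent vectors in a chart\<close>

lemma chart_inv_eq:
  assumes "smooth_manifold M" "c \<in> atlas M" "x \<in> fst c"
  shows "chart_inv c (snd c x) = x"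
proof -
  have "openin (mtop M) (fst c)"
    and "homeomorphic_map (subtopology (mtop M) (fst c)) (top_of_set (chart_image c)) (snd c)"
    using assms by (auto simp: smooth_manifold_def)
  then have "inj_on (snd c) (fst c)"
    using homeomorphic_imp_injective_map topspace_subtopology_subset openin_subset by metis
  then show ?thesis using assms(3) by simp
qed

lemma open_chart_image: "smooth_manifold M \<Longrightarrow> c \<in> atlas M \<Longrightarrow> open (chart_image c)"
  by (simp add: smooth_manifold_def)

lemma chart_subset: "smooth_manifold M \<Longrightarrow> c \<in> atlas M \<Longrightarrow> fst c \<subseteq> topspace (mtop M)"
  by (auto simp: smooth_manifold_def)

text \<open>A chart is a homeomorphism onto an open set. Openness of the overlap allows identities
  between transition maps that hold only there to be differentiated.\<close>

lemma open_chart_overlap: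
  assumes "smooth_manifold M" "c \<in> atlas M" "d \<in> atlas M"
  shows "open (snd c ` (fst c \<inter> fst d))"
proof -
  have "openin (mtop M) (fst c)" "openin (mtop M) (fst d)" "open (chart_image c)"
    and hom: "homeomorphic_map (subtopology (mtop M) (fst c)) (top_of_set (chart_image c)) (snd c)"
    using assms by (auto simp: smooth_manifold_def)
  then have "openin (top_of_set (chart_image c)) (snd c ` (fst c \<inter> fst d))"
    using homeomorphic_imp_open_map[OF hom] openin_subtopology_Int2[of "mtop M" "fst d" "fst c"]
    by (simp add: open_map_def Int_commute)
  then show ?thesis using \<open>open (chart_image c)\<close> openin_open_eq by blast
qed

lemma transition_has_derivative:
  assumes "smooth_manifold M" "c \<in> atlas M" "d \<in> atlas M" "x \<in> fst c" "x \<in> fst d"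
  shows "(transition c d has_derivative frechet_derivative (transition c d) (at (snd c x)))
    (at (snd c x))"
proof -
  have "smooth_on (snd c ` (fst c \<inter> fst d)) (transition c d)"
    using assms by (simp add: smooth_manifold_def)
  then have "Ck_on (Suc 0) (snd c ` (fst c \<inter> fst d)) (transition c d)"
    unfolding smooth_on_def by blast
  then show ?thesis by (rule Ck_on_Suc_has_derivative) (use assms in auto)
qed

lemma transition_eq:
  assumes "smooth_manifold M" "c \<in> atlas M" "x \<in> fst c"
  shows "transition c d (snd c x) = snd d x"
  using chart_inv_eq[OF assms] by (simp add: transition_def)

lemma frechet_derivative_transition_self:
  assumes "smooth_manifold M" "c \<in> atlas M" "x \<in> fst c"
  shows "frechet_derivative (transition c c) (at (snd c x)) u = u"
proof -
  have "(transition c c has_derivative (\<lambda>u. u)) (at (snd c x))"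
    by (rule has_derivative_transform_within_open[OF has_derivative_ident
          open_chart_image[OF assms(1,2)]])
       (use assms in \<open>auto simp: transition_eq\<close>)
  from frechet_derivative_at[OF this] show ?thesis by metis
qed

text \<open>This is the chain rule for the cocycle identity of the transition maps, which holds on
  the open overlap of \<open>c\<close> and \<open>d\<close>.\<close>

lemma frechet_derivative_transition_compose:
  assumes M: "smooth_manifold M" and at: "c \<in> atlas M" "d \<in> atlas M" "e \<in> atlas M"
    and x: "x \<in> fst c" "x \<in> fst d" "x \<in> fst e"
  shows "frechet_derivative (transition d e) (at (snd d x))
      (frechet_derivative (transition c d) (at (snd c x)) u)
    = frechet_derivative (transition c e) (at (snd c x)) u"
proof -
  have eq: "transition d e (transition c d y) = transition c e y"
    if "y \<in> snd c ` (fst c \<inter> fst d)" for y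
    using that M at by (auto simp: transition_eq)
  have "(transition d e \<circ> transition c d has_derivative
      frechet_derivative (transition d e) (at (snd d x))
      \<circ> frechet_derivative (transition c d) (at (snd c x))) (at (snd c x))"
    using transition_has_derivative[OF M at(1,2) x(1,2)]
      transition_has_derivative[OF M at(2,3) x(2,3)]
    by (intro diff_chain_at) (simp_all add: transition_eq[OF M at(1) x(1)])
  then have "(transition c e has_derivative
      frechet_derivative (transition d e) (at (snd d x))
      \<circ> frechet_derivative (transition c d) (at (snd c x))) (at (snd c x))"
    by (rule has_derivative_transform_within_open[OF _ open_chart_overlap[OF M at(1,2)]])
       (use x eq in auto)
  from frechet_derivative_at[OF this] show ?thesis by (metis comp_apply)
qed

text \<open>The transformation law for \<open>coord_vec\<close> is the differentiated cocycle
  identity. Together with the next lemmas this identifies the tangent space at \<open>x\<close> with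
  the coordinate space of \<open>c\<close>.\<close>

lemma coord_vec_tangent:
  assumes "smooth_manifold M" "c \<in> atlas M" "x \<in> fst c"
  shows "coord_vec M c x u \<in> tangent_space M x"
  using frechet_derivative_transition_compose[OF assms(1,2) _ _ assms(3)]
  by (auto simp: tangent_space_def coord_vec_def)

lemma coord_vec_self:
  assumes "smooth_manifold M" "c \<in> atlas M" "x \<in> fst c"
  shows "coord_vec M c x u c = u"
  using assms by (simp add: coord_vec_def frechet_derivative_transition_self)

lemma tangent_vec_outside_chart:
  assumes "v \<in> tangent_space M x" "\<not> (c \<in> atlas M \<and> x \<in> fst c)"
  shows "v c = 0"
  using assms unfolding tangent_space_def by blast

lemma coord_vec_of_component:
  assumes "smooth_manifold M" "c \<in> atlas M" "x \<in> fst c" "v \<in> tangent_space M x"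
  shows "coord_vec M c x (v c) = v"
proof
  fix d
  show "coord_vec M c x (v c) d = v d"
  proof (cases "d \<in> atlas M \<and> x \<in> fst d")
    case True
    then have "v d = frechet_derivative (transition c d) (at (snd c x)) (v c)"
      using assms(2,3,4) unfolding tangent_space_def by blast
    then show ?thesis using True by (simp only: coord_vec_def simp_thms if_True)
  next
    case False
    then show ?thesis
      using tangent_vec_outside_chart[OF assms(4) False] by (simp only: coord_vec_def if_False)
  qed
qed

lemma coord_vec_linear_combination:
  assumes "smooth_manifold M" "c \<in> atlas M" "x \<in> fst c"
  shows "coord_vec M c x (a *\<^sub>R u + b *\<^sub>R w) =
    (\<lambda>d. a *\<^sub>R coord_vec M c x u d + b *\<^sub>R coord_vec M c x w d)"
proof
  fix d
  have "linear (frechet_derivative (transition c d) (at (snd c x)))" if "d \<in> atlas M" "x \<in> fst d"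
    using transition_has_derivative[OF assms(1,2) that(1) assms(3) that(2)]
    by (rule has_derivative_linear)
  then show "coord_vec M c x (a *\<^sub>R u + b *\<^sub>R w) d =
      a *\<^sub>R coord_vec M c x u d + b *\<^sub>R coord_vec M c x w d"
    by (auto simp: coord_vec_def linear_add linear_scale)
qed


section \<open>Forms on a 3-manifold in a chart\<close>

lemma linear_eq_inner_axis:
  fixes a :: "real ^ 'n \<Rightarrow> real"
  assumes "linear a"
  shows "a u = (\<chi> i. a (axis i 1)) \<bullet> u"
proof -
  have "a u = a (\<Sum>i\<in>UNIV. u $ i *\<^sub>R axis i 1)"
    using basis_expansion[of u] by (simp add: scalar_mult_eq_scaleR)
  also have "\<dots> = (\<Sum>i\<in>UNIV. u $ i * a (axis i 1))"
    by (simp add: linear_sum[OF assms] linear_scale[OF assms])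
  finally show ?thesis by (simp add: inner_vec_def mult.commute)
qed

text \<open>In a basis expansion skew-symmetry leaves three independent coefficients. They are the
  coordinates of the vector whose contraction with the volume form is \<open>b\<close>.\<close>

lemma alternating_bilinear_eq_cross3:
  fixes b :: "real ^ 3 \<Rightarrow> real ^ 3 \<Rightarrow> real"
  assumes l1: "\<And>w. linear (\<lambda>u. b u w)" and l2: "\<And>u. linear (b u)" and alt: "\<And>u. b u u = 0"
  shows "b u w = vector [b (axis 2 1) (axis 3 1), b (axis 3 1) (axis 1 1),
    b (axis 1 1) (axis 2 1)] \<bullet> cross3 u w"
proof -
  have skew: "b u w = - b w u" for u w
    using alt[of "u + w"] alt[of u] alt[of w]
    by (simp add: linear_add[OF l1] linear_add[OF l2])
  have "b u w = (\<Sum>i\<in>UNIV. \<Sum>j\<in>UNIV. b (axis i 1) (axis j 1) * u $ i * w $ j)"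
    by (subst linear_eq_inner_axis[OF l1], subst linear_eq_inner_axis[OF l2])
       (simp add: inner_vec_def sum_distrib_left sum_distrib_right mult_ac)
  then show ?thesis
    using skew[of "axis 2 1" "axis 1 1"] skew[of "axis 3 1" "axis 1 1"]
      skew[of "axis 3 1" "axis 2 1"] alt
    by (simp add: cross3_def inner_vec_def sum_3 algebra_simps)
qed

text \<open>In a chart a 1-form is the inner product with a vector field \<open>covec\<close>; by means of the
  standard volume form a 2-form is turned into a vector field \<open>bivec\<close>.\<close>

definition covec :: "('a, 3) manifold \<Rightarrow> ('a, 3) chart \<Rightarrow> ('a, 3) form \<Rightarrow> real ^ 3 \<Rightarrow> real ^ 3" where
  "covec M c \<eta> y = (\<chi> i. local_rep M c \<eta> y [axis i 1])"

definition bivec :: "('a, 3) manifold \<Rightarrow> ('a, 3) chart \<Rightarrow> ('a, 3) form \<Rightarrow> real ^ 3 \<Rightarrow> real ^ 3" where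
  "bivec M c \<Omega> y = vector [local_rep M c \<Omega> y [axis 2 1, axis 3 1],
     local_rep M c \<Omega> y [axis 3 1, axis 1 1], local_rep M c \<Omega> y [axis 1 1, axis 2 1]]"

lemma one_form_eq_covec:
  assumes M: "smooth_manifold M" "c \<in> atlas M" "x \<in> fst c"
    and "differential_form M 1 \<eta>" "v \<in> tangent_space M x"
  shows "\<eta> x [v] = covec M c \<eta> (snd c x) \<bullet> v c"
proof -
  have alt: "alternating_at M 1 x (\<eta> x)"
    using assms(4) subsetD[OF chart_subset[OF M(1,2)] M(3)] by (simp add: differential_form_def)
  have "\<eta> x [\<lambda>d. a *\<^sub>R u d + b *\<^sub>R w d] = a * \<eta> x [u] + b * \<eta> x [w]"
    if "u \<in> tangent_space M x" "w \<in> tangent_space M x" for u w a b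
    using bspec[OF alt[unfolded alternating_at_def], of "[u]"] that
    by (auto simp: tangent_tuples_def)
  then have eq: "\<eta> x [coord_vec M c x (a *\<^sub>R u + b *\<^sub>R w)]
      = a * \<eta> x [coord_vec M c x u] + b * \<eta> x [coord_vec M c x w]" for a b u w
    by (simp add: coord_vec_linear_combination[OF M] coord_vec_tangent[OF M])
  have "linear (\<lambda>u. \<eta> x [coord_vec M c x u])"
    \<comment> \<open>Additivity is the case a = b = 1, homogeneity the case b = 0.\<close>
    by (rule linearI) (use eq[of 1 _ 1] eq[of _ _ 0] in auto)
  from linear_eq_inner_axis[OF this, of "v c"] show ?thesis
    using assms by (simp add: covec_def local_rep_def chart_inv_eq coord_vec_of_component)
qed

lemma two_form_eq_bivec:
  assumes M: "smooth_manifold M" "c \<in> atlas M" "x \<in> fst c"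
    and "differential_form M 2 \<Omega>" "v \<in> tangent_space M x" "w \<in> tangent_space M x"
  shows "\<Omega> x [v, w] = bivec M c \<Omega> (snd c x) \<bullet> cross3 (v c) (w c)"
proof -
  have alt: "alternating_at M 2 x (\<Omega> x)"
    using assms(4) subsetD[OF chart_subset[OF M(1,2)] M(3)] by (simp add: differential_form_def)
  have altD: "\<Omega> x ([t, s][i := (\<lambda>d. a *\<^sub>R u d + b *\<^sub>R w d)])
      = a * \<Omega> x ([t, s][i := u]) + b * \<Omega> x ([t, s][i := w])" "\<Omega> x [t, t] = 0"
    if "u \<in> tangent_space M x" "w \<in> tangent_space M x" "t \<in> tangent_space M x"
      "s \<in> tangent_space M x" "i < 2" for u w t s a b i
  proof -
    show "\<Omega> x ([t, s][i := (\<lambda>d. a *\<^sub>R u d + b *\<^sub>R w d)])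
      = a * \<Omega> x ([t, s][i := u]) + b * \<Omega> x ([t, s][i := w])"
      using bspec[OF alt[unfolded alternating_at_def], of "[t, s]"] that
      by (auto simp: tangent_tuples_def)
    have "[t, t] \<in> tangent_tuples M 2 x" using that by (auto simp: tangent_tuples_def)
    from bspec[OF alt[unfolded alternating_at_def] this, rule_format, of 0, THEN conjunct2,
        rule_format, of 1]
    show "\<Omega> x [t, t] = 0" by simp
  qed
  define E where "E = coord_vec M c x"
  note E = coord_vec_tangent[OF M, folded E_def]
    and lin = coord_vec_linear_combination[OF M, folded E_def]
  define b where "b u w = \<Omega> x [E u, E w]" for u w
  have b1: "b (\<alpha> *\<^sub>R u + \<beta> *\<^sub>R w) t = \<alpha> * b u t + \<beta> * b w t" for \<alpha> \<beta> u w t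
    \<comment> \<open>The base list \<open>[E t, E t]\<close> only supplies the other argument; its
      entry at the chosen slot is overwritten.\<close>
    using altD(1)[of "E u" "E w" "E t" "E t" 0 \<alpha> \<beta>]
    by (simp add: b_def lin E)
  have b2: "b t (\<alpha> *\<^sub>R u + \<beta> *\<^sub>R w) = \<alpha> * b t u + \<beta> * b t w" for \<alpha> \<beta> u w t
    using altD(1)[of "E u" "E w" "E t" "E t" 1 \<alpha> \<beta>]
    by (simp add: b_def lin E)
  have "linear (\<lambda>u. b u t)" "linear (b t)" for t
    by (rule linearI; use b1[of 1 _ 1] b1[of _ _ 0] b2[of _ 1 _ 1] b2[of _ _ _ 0] in auto)+
  moreover have "b u u = 0" for u
    using altD(2)[of "E u" "E u" "E u" "E u" 0]
    by (simp add: b_def E)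
  ultimately have "b (v c) (w c) = vector [b (axis 2 1) (axis 3 1), b (axis 3 1) (axis 1 1),
      b (axis 1 1) (axis 2 1)] \<bullet> cross3 (v c) (w c)"
    by (rule alternating_bilinear_eq_cross3)
  then show ?thesis
    using assms by (simp add: b_def E_def bivec_def local_rep_def chart_inv_eq coord_vec_of_component)
qed

section \<open>Wedge products in low degree and the cosymplectic volume\<close>

lemma wedge_power_2_1:
  "wedge_power 2 \<Omega> 1 x [u, v] = (\<Omega> x [u, v] - \<Omega> x [v, u]) / 2"
proof -
  \<comment> \<open>The power is the wedge of \<open>\<Omega>\<close> with the constant 0-form 1, so
    the sum runs over two permutations and the divisor is \<open>fact 2 * fact 0\<close>. For skew
    \<open>\<Omega>\<close> the result is \<open>\<Omega>\<close> again.\<close>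
  have "{..<2} = {0, Suc 0}" by auto
  then show ?thesis
    by (simp add: wedge_def sum_over_permutations_insert sign_compose sign_swap_id
        permutation_swap_id upt_rec numeral_2_eq_2)
qed

text \<open>Skewness of \<open>\<beta>\<close> makes the six permutations agree in pairs. This
  cancels the divisor \<open>fact 1 * fact 2\<close> and leaves one term per shuffle.\<close>

lemma wedge_1_2:
  assumes "\<And>u v. \<beta> x [v, u] = - \<beta> x [u, v]"
  shows "wedge 1 2 \<alpha> \<beta> x [a, b, c] =
    \<alpha> x [a] * \<beta> x [b, c] - \<alpha> x [b] * \<beta> x [a, c] + \<alpha> x [c] * \<beta> x [a, b]"
proof -
  have "{..<3} = {0, Suc 0, Suc (Suc 0)}" by auto
  then show ?thesis
    by (simp add: wedge_def sum_over_permutations_insert sign_compose sign_swap_id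
        permutation_swap_id permutation_compose upt_rec numeral_2_eq_2 numeral_3_eq_3
        assms[of a b] assms[of a c] assms[of b c])
qed

text \<open>For the covector h and the contraction of the volume form with X, the wedge product is
  (h . X) times the volume form: contract the vanishing 4-form h wedge vol with X.\<close>

lemma inner_cross3_cyclic_expansion:
  fixes h X u v w :: "real ^ 3"
  shows "(h \<bullet> u) * (X \<bullet> cross3 v w) - (h \<bullet> v) * (X \<bullet> cross3 u w) + (h \<bullet> w) * (X \<bullet> cross3 u v) =
    (h \<bullet> X) * (u \<bullet> cross3 v w)"
  by (simp add: cross3_simps)

lemma cosymplectic_volume_eq:
  assumes M: "smooth_manifold M" "c \<in> atlas M" "x \<in> fst c"
    and "differential_form M 1 \<eta>" "differential_form M 2 \<Omega>"
    and "u \<in> tangent_space M x" "v \<in> tangent_space M x" "w \<in> tangent_space M x"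
  shows "cosymplectic_volume 1 \<eta> \<Omega> x [u, v, w] =
    (covec M c \<eta> (snd c x) \<bullet> bivec M c \<Omega> (snd c x)) * (u c \<bullet> cross3 (v c) (w c))"
proof -
  have skew: "wedge_power 2 \<Omega> 1 x [w, v] = - wedge_power 2 \<Omega> 1 x [v, w]" for v w
    unfolding wedge_power_2_1 by (simp add: field_simps)
  have 2: "wedge_power 2 \<Omega> 1 x [v, w] = bivec M c \<Omega> (snd c x) \<bullet> cross3 (v c) (w c)"
    if "v \<in> tangent_space M x" "w \<in> tangent_space M x" for v w
    unfolding wedge_power_2_1 using that assms cross_skew[of "w c" "v c"]
    by (simp add: two_form_eq_bivec[OF M])
  have "cosymplectic_volume 1 \<eta> \<Omega> x [u, v, w] = \<eta> x [u] * wedge_power 2 \<Omega> 1 x [v, w]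
      - \<eta> x [v] * wedge_power 2 \<Omega> 1 x [u, w] + \<eta> x [w] * wedge_power 2 \<Omega> 1 x [u, v]"
    unfolding cosymplectic_volume_def mult_1_right by (rule wedge_1_2) (rule skew)
  also have "\<dots> =
      (covec M c \<eta> (snd c x) \<bullet> bivec M c \<Omega> (snd c x)) * (u c \<bullet> cross3 (v c) (w c))"
    by (simp only: 2 one_form_eq_covec[OF M] assms inner_cross3_cyclic_expansion)
  finally show ?thesis .
qed


section \<open>The Reeb vector field\<close>

text \<open>The kernel of the 2-form given by \<open>X\<close> is the line through \<open>X\<close>,
  and \<open>h\<close> fixes the scale. Concretely, the second condition says that X x v = 0, and
  the expansion h x (X x v) = (h . v) X - (h . X) v then gives X = (h . X) v.\<close>

lemma reeb_direction:
  fixes h X v :: "real ^ 3"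
  assumes "h \<bullet> X \<noteq> 0"
  shows "h \<bullet> v = 1 \<and> (\<forall>w. X \<bullet> cross3 v w = 0) \<longleftrightarrow> v = X /\<^sub>R (h \<bullet> X)"
proof
  assume v: "h \<bullet> v = 1 \<and> (\<forall>w. X \<bullet> cross3 v w = 0)"
  have "cross3 X v \<bullet> w = X \<bullet> cross3 v w" for w
    by (simp add: cross3_simps)
  then have "cross3 X v = 0" using v inner_eq_zero_iff by metis
  then have "cross3 h (cross3 X v) = 0" by simp
  then have "X = (h \<bullet> X) *\<^sub>R v" using v by (simp add: Lagrange)
  then have "X /\<^sub>R (h \<bullet> X) = ((h \<bullet> X) *\<^sub>R v) /\<^sub>R (h \<bullet> X)" by metis
  then show "v = X /\<^sub>R (h \<bullet> X)" using assms by simp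
next
  assume "v = X /\<^sub>R (h \<bullet> X)"
  then show "h \<bullet> v = 1 \<and> (\<forall>w. X \<bullet> cross3 v w = 0)"
    using assms by (simp add: cross_mult_left dot_cross_self)
qed

definition reeb_coord ::
    "('a, 3) manifold \<Rightarrow> ('a, 3) chart \<Rightarrow> ('a, 3) form \<Rightarrow> ('a, 3) form \<Rightarrow> real ^ 3 \<Rightarrow> real ^ 3" where
  "reeb_coord M c \<eta> \<Omega> y = bivec M c \<Omega> y /\<^sub>R (covec M c \<eta> y \<bullet> bivec M c \<Omega> y)"

text \<open>The components are prescribed in all charts at once, with no choice of a chart; that
  they obey the transformation law is the content of \<open>reeb_field_eq_vec\<close>. The value 0
  follows the convention of \<open>tangent_space\<close>.\<close>

definition reeb_field ::
    "('a, 3) manifold \<Rightarrow> ('a, 3) form \<Rightarrow> ('a, 3) form \<Rightarrow> 'a \<Rightarrow> ('a, 3) tvec" where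
  "reeb_field M \<eta> \<Omega> x =
     (\<lambda>c. if c \<in> atlas M \<and> x \<in> fst c then reeb_coord M c \<eta> \<Omega> (snd c x) else 0)"

lemma cosymplectic_imp_forms:
  assumes "cosymplectic 1 M \<eta> \<Omega>"
  shows "differential_form M 1 \<eta>" "differential_form M 2 \<Omega>"
  using assms by (auto simp: cosymplectic_def closed_form_def)

lemma tangent_tuples_3E:
  assumes "vs \<in> tangent_tuples M 3 x"
  obtains u v w where "vs = [u, v, w]" "u \<in> tangent_space M x" "v \<in> tangent_space M x"
    "w \<in> tangent_space M x"
proof -
  have "length vs = Suc (Suc (Suc 0))" and set: "set vs \<subseteq> tangent_space M x"
    using assms by (simp_all add: tangent_tuples_def)
  then obtain u v w where "vs = [u, v, w]" unfolding length_Suc_conv length_0_conv by blast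
  then show thesis using that set by simp
qed

lemma cosymplectic_nondegenerate:
  assumes M: "smooth_manifold M" "c \<in> atlas M" "x \<in> fst c" and "cosymplectic 1 M \<eta> \<Omega>"
  shows "covec M c \<eta> (snd c x) \<bullet> bivec M c \<Omega> (snd c x) \<noteq> 0"
proof -
  have "x \<in> topspace (mtop M)" using chart_subset[OF M(1,2)] M(3) by blast
  then obtain vs where vs: "vs \<in> tangent_tuples M 3 x" "cosymplectic_volume 1 \<eta> \<Omega> x vs \<noteq> 0"
    using assms(4) by (auto simp: cosymplectic_def nowhere_zero_def)
  then obtain u v w where "vs = [u, v, w]" using tangent_tuples_3E by metis
  then show ?thesis
    using vs cosymplectic_volume_eq[OF M cosymplectic_imp_forms[OF assms(4)], of u v w]
    by (auto simp: tangent_tuples_def)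
qed

text \<open>Every coordinate vector is the component of a tangent vector, so the condition on all
  \<open>w\<close> becomes one on all of three-space and \<open>reeb_direction\<close> applies. The
  left side mentions no chart, which makes this the tool for comparing charts.\<close>

lemma reeb_vector_iff:
  assumes M: "smooth_manifold M" "c \<in> atlas M" "x \<in> fst c" and cs: "cosymplectic 1 M \<eta> \<Omega>"
    and v: "v \<in> tangent_space M x"
  shows "\<eta> x [v] = 1 \<and> (\<forall>w\<in>tangent_space M x. \<Omega> x [v, w] = 0) \<longleftrightarrow>
    v c = reeb_coord M c \<eta> \<Omega> (snd c x)"
proof -
  note forms = cosymplectic_imp_forms[OF cs]
  let ?X = "bivec M c \<Omega> (snd c x)"
  have "(\<forall>w\<in>tangent_space M x. \<Omega> x [v, w] = 0) \<longleftrightarrow> (\<forall>u. ?X \<bullet> cross3 (v c) u = 0)"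
    (is "?L \<longleftrightarrow> ?R")
  proof
    assume L: ?L
    show ?R
    proof
      fix u
      show "?X \<bullet> cross3 (v c) u = 0"
        using L two_form_eq_bivec[OF M forms(2) v coord_vec_tangent[OF M], of u]
        by (simp add: coord_vec_tangent[OF M] coord_vec_self[OF M])
    qed
  qed (use two_form_eq_bivec[OF M forms(2) v] in auto)
  then show ?thesis
    using reeb_direction[OF cosymplectic_nondegenerate[OF M cs], of "v c"]
      one_form_eq_covec[OF M forms(1) v]
    by (simp add: reeb_coord_def)
qed

lemma is_reeb_iff_pointwise:
  "is_reeb M \<eta> \<Omega> \<xi> \<longleftrightarrow> vector_field M \<xi> \<and>
    (\<forall>x\<in>topspace (mtop M). \<eta> x [\<xi> x] = 1 \<and> (\<forall>w\<in>tangent_space M x. \<Omega> x [\<xi> x, w] = 0))"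
proof -
  have "tangent_tuples M 0 x = {[]}" "tangent_tuples M 1 x = (\<lambda>w. [w]) ` tangent_space M x" for x
    by (auto simp: tangent_tuples_def length_Suc_conv)
  then show ?thesis
    unfolding is_reeb_def form_eq_def interior_product_def by auto
qed

text \<open>The vector with the right component in \<open>c\<close> solves the chart-free Reeb
  equations, hence has the right component in every other chart \<open>d\<close>. This takes the
  place of transformation laws for \<open>covec\<close> and \<open>bivec\<close>.\<close>

lemma reeb_field_eq_vec:
  assumes M: "smooth_manifold M" "c \<in> atlas M" "x \<in> fst c" and cs: "cosymplectic 1 M \<eta> \<Omega>"
  shows "reeb_field M \<eta> \<Omega> x = coord_vec M c x (reeb_coord M c \<eta> \<Omega> (snd c x))"
    (is "_ = ?v")
proof
  fix d
  have "\<eta> x [?v] = 1 \<and> (\<forall>w\<in>tangent_space M x. \<Omega> x [?v, w] = 0)"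
    by (simp add: reeb_vector_iff[OF M cs coord_vec_tangent[OF M]] coord_vec_self[OF M])
  then have "?v d = reeb_coord M d \<eta> \<Omega> (snd d x)" if "d \<in> atlas M" "x \<in> fst d"
    using reeb_vector_iff[OF M(1) that cs coord_vec_tangent[OF M]] by blast
  moreover have "?v d = 0" if "\<not> (d \<in> atlas M \<and> x \<in> fst d)"
    using tangent_vec_outside_chart[OF coord_vec_tangent[OF M] that] .
  ultimately show "reeb_field M \<eta> \<Omega> x d = ?v d"
    unfolding reeb_field_def by simp
qed

lemma Ck_on_reeb_coord:
  assumes M: "smooth_manifold M" "c \<in> atlas M" and cs: "cosymplectic 1 M \<eta> \<Omega>"
  shows "Ck_on k (chart_image c) (reeb_coord M c \<eta> \<Omega>)"
proof -
  note op = open_chart_image[OF M]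
  have rep: "Ck_on k (chart_image c) (\<lambda>y. local_rep M c \<eta> y [u])"
    "Ck_on k (chart_image c) (\<lambda>y. local_rep M c \<Omega> y [u, v])" for u v
    using cosymplectic_imp_forms[OF cs] M(2) by (simp_all add: differential_form_def smooth_on_def)
  have h: "Ck_on k (chart_image c) (covec M c \<eta>)"
    by (rule Ck_on_vecI[OF op]) (simp add: covec_def rep)
  have X: "Ck_on k (chart_image c) (bivec M c \<Omega>)"
  proof (rule Ck_on_vecI[OF op])
    show "Ck_on k (chart_image c) (\<lambda>y. bivec M c \<Omega> y $ i)" for i
      using exhaust_3[of i] by (auto simp: bivec_def rep)
  qed
  have "covec M c \<eta> y \<bullet> bivec M c \<Omega> y \<noteq> 0" if "y \<in> chart_image c" for y
    using that cosymplectic_nondegenerate[OF M _ cs] by auto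
  then show ?thesis
    unfolding reeb_coord_def
    by (intro Ck_on_bounded_bilinear[OF bounded_bilinear_scaleR op] Ck_on_inverse[OF op] X
        Ck_on_bounded_bilinear[OF bounded_bilinear_inner op h])
qed

lemma topspace_in_chart:
  assumes "smooth_manifold M" "x \<in> topspace (mtop M)"
  obtains c where "c \<in> atlas M" "x \<in> fst c"
proof -
  have "(\<Union>c\<in>atlas M. fst c) = topspace (mtop M)"
    using assms(1) unfolding smooth_manifold_def by (elim conjE)
  then show thesis using assms(2) that by blast
qed

lemma vector_field_reeb_field:
  assumes M: "smooth_manifold M" and cs: "cosymplectic 1 M \<eta> \<Omega>"
  shows "vector_field M (reeb_field M \<eta> \<Omega>)"
  unfolding vector_field_def
proof (intro conjI allI ballI)
  fix x
  show "reeb_field M \<eta> \<Omega> x \<in> tangent_space M x"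
  proof (cases "\<exists>c\<in>atlas M. x \<in> fst c")
    case True
    then obtain c where c: "c \<in> atlas M" "x \<in> fst c" by blast
    show ?thesis unfolding reeb_field_eq_vec[OF M c cs] by (rule coord_vec_tangent[OF M c])
  next
    case False
    \<comment> \<open>Off all charts the field is zero, the only tangent vector there.\<close>
    then show ?thesis by (auto simp: tangent_space_def reeb_field_def)
  qed
next
  fix c assume c: "c \<in> atlas M"
  have "reeb_coord M c \<eta> \<Omega> y = reeb_field M \<eta> \<Omega> (chart_inv c y) c"
    if y: "y \<in> chart_image c" for y
  proof -
    obtain x where "x \<in> fst c" "y = snd c x" using y by blast
    then show ?thesis using c by (simp add: reeb_field_def chart_inv_eq[OF M c])
  qed
  then show "smooth_on (chart_image c) (\<lambda>y. reeb_field M \<eta> \<Omega> (chart_inv c y) c)"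
    unfolding smooth_on_def
    by (intro allI Ck_on_cong[OF open_chart_image[OF M c] _ Ck_on_reeb_coord[OF M c cs]])
qed

text \<open>Tangent vectors vanish at charts that do not contain the point, so uniqueness holds as
  equality of functions. This is what lets the definite description in \<open>reeb\<close> be
  evaluated.\<close>

lemma is_reeb_iff:
  assumes M: "smooth_manifold M" and cs: "cosymplectic 1 M \<eta> \<Omega>"
  shows "is_reeb M \<eta> \<Omega> \<xi> \<longleftrightarrow> \<xi> = reeb_field M \<eta> \<Omega>"
proof
  assume reeb: "is_reeb M \<eta> \<Omega> \<xi>"
  show "\<xi> = reeb_field M \<eta> \<Omega>"
  proof (intro ext)
    fix x c
    have tangent: "\<xi> x \<in> tangent_space M x"
      using reeb by (simp add: is_reeb_def vector_field_def)
    show "\<xi> x c = reeb_field M \<eta> \<Omega> x c"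
    proof (cases "c \<in> atlas M \<and> x \<in> fst c")
      case True
      then have "x \<in> topspace (mtop M)" using chart_subset[OF M] by blast
      then show ?thesis
        using True reeb reeb_vector_iff[OF M _ _ cs tangent, of c]
        by (simp add: is_reeb_iff_pointwise reeb_field_def)
    next
      case False
      then show ?thesis
        using tangent_vec_outside_chart[OF tangent False] by (auto simp: reeb_field_def)
    qed
  qed
next
  have "\<eta> x [reeb_field M \<eta> \<Omega> x] = 1 \<and>
      (\<forall>w\<in>tangent_space M x. \<Omega> x [reeb_field M \<eta> \<Omega> x, w] = 0)"
    if x: "x \<in> topspace (mtop M)" for x
  proof -
    obtain c where c: "c \<in> atlas M" "x \<in> fst c" using topspace_in_chart[OF M x] .
    have "reeb_field M \<eta> \<Omega> x \<in> tangent_space M x"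
      using vector_field_reeb_field[OF M cs] by (simp add: vector_field_def)
    then show ?thesis using reeb_vector_iff[OF M c cs] c by (simp add: reeb_field_def)
  qed
  then have "is_reeb M \<eta> \<Omega> (reeb_field M \<eta> \<Omega>)"
    using vector_field_reeb_field[OF M cs] by (simp add: is_reeb_iff_pointwise)
  then show "\<xi> = reeb_field M \<eta> \<Omega> \<Longrightarrow> is_reeb M \<eta> \<Omega> \<xi>" by simp
qed

lemma reeb_eq_reeb_field:
  assumes "smooth_manifold M" "cosymplectic 1 M \<eta> \<Omega>"
  shows "reeb M \<eta> \<Omega> = reeb_field M \<eta> \<Omega>"
  using is_reeb_iff[OF assms] by (simp add: reeb_def)


section \<open>Taut and round spheres\<close>

lemma covec_comb_form:
  "covec M c (comb_form p l \<eta>) y = (\<Sum>i\<le>p. l i *\<^sub>R covec M c (\<eta> i) y)"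
  by (simp add: covec_def comb_form_def local_rep_def vec_eq_iff)

lemma bivec_comb_form:
  "bivec M c (comb_form p l \<Omega>) y = (\<Sum>i\<le>p. l i *\<^sub>R bivec M c (\<Omega> i) y)"
  by (simp add: bivec_def comb_form_def local_rep_def vec_eq_iff forall_3)

lemma nsphere_iff: "l \<in> topspace (nsphere p) \<longleftrightarrow> (\<Sum>i\<le>p. (l i)\<^sup>2) = 1 \<and> (\<forall>i>p. l i = 0)"
  by (simp add: nsphere)

text \<open>By homogeneity, nondegeneracy on the sphere makes
  \<open>l \<mapsto> \<Sum>i\<le>p. l i *\<^sub>R X i\<close> injective, so the coefficients in the equation for the Reeb
  fields can be compared.\<close>

lemma taut_iff_round_pointwise:
  fixes h X :: "nat \<Rightarrow> 'v::real_inner" and p :: nat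
  defines "H \<equiv> \<lambda>l. \<Sum>i\<le>p. l i *\<^sub>R h i" and "Y \<equiv> \<lambda>l. \<Sum>i\<le>p. l i *\<^sub>R X i"
  assumes nz: "\<And>l. l \<in> topspace (nsphere p) \<Longrightarrow> H l \<bullet> Y l \<noteq> 0"
  shows "(\<forall>l\<in>topspace (nsphere p). \<forall>\<mu>\<in>topspace (nsphere p). H l \<bullet> Y l = H \<mu> \<bullet> Y \<mu>) \<longleftrightarrow>
    (\<forall>l\<in>topspace (nsphere p). (\<Sum>i\<le>p. l i *\<^sub>R (X i /\<^sub>R (h i \<bullet> X i))) = Y l /\<^sub>R (H l \<bullet> Y l))"
    (is "?taut \<longleftrightarrow> ?round")
proof
  \<comment> \<open>The unit vectors of the sphere, at which \<open>H\<close> and \<open>Y\<close>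
    return the generators.\<close>
  define e :: "nat \<Rightarrow> nat \<Rightarrow> real" where "e i j = (if j = i then 1 else 0)" for i j
  have e: "e i \<in> topspace (nsphere p)" "H (e i) = h i" "Y (e i) = X i" if "i \<le> p" for i
    using that
    by (simp_all add: e_def H_def Y_def nsphere_iff if_distrib[of "\<lambda>x. x\<^sup>2"]
        if_distrib[of "\<lambda>x. x *\<^sub>R _"] cong: if_cong)
  {
    assume taut: ?taut
    show ?round
    proof
      fix l assume l: "l \<in> topspace (nsphere p)"
      \<comment> \<open>Tautness compares \<open>l\<close> with \<open>e i\<close>, so all the
        denominators are equal and can be pulled out of the sum.\<close>
      have "h i \<bullet> X i = H l \<bullet> Y l" if "i \<le> p" for i
        using taut l e[OF that] by metis
      then show "(\<Sum>i\<le>p. l i *\<^sub>R (X i /\<^sub>R (h i \<bullet> X i))) = Y l /\<^sub>R (H l \<bullet> Y l)"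
        by (simp add: Y_def scaleR_sum_right mult.commute)
    qed
  }
  assume round: ?round
  have inj: "g i = 0" if "(\<Sum>i\<le>p. g i *\<^sub>R X i) = 0" "i \<le> p" for g i
  proof (rule ccontr)
    assume "g i \<noteq> 0"
    define N where "N = (\<Sum>i\<le>p. (g i)\<^sup>2)"
    have "N > 0" unfolding N_def using \<open>g i \<noteq> 0\<close> \<open>i \<le> p\<close> by (intro sum_pos2[of _ i]) auto
    \<comment> \<open>A nontrivial vanishing combination is rescaled to a point of the sphere with
      \<open>Y l = 0\<close>, against \<open>nz\<close>. The cut-off at \<open>p\<close> is there
      because points of \<open>nsphere p\<close> vanish beyond index \<open>p\<close>.\<close>
    define l where "l j = (if j \<le> p then g j / sqrt N else 0)" for j
    have "(\<Sum>j\<le>p. (l j)\<^sup>2) = (\<Sum>j\<le>p. (g j)\<^sup>2) / N"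
      using \<open>N > 0\<close> by (simp add: l_def power_divide sum_divide_distrib)
    then have "l \<in> topspace (nsphere p)" using \<open>N > 0\<close> by (simp add: nsphere_iff l_def N_def)
    moreover have "Y l = (\<Sum>i\<le>p. g i *\<^sub>R X i) /\<^sub>R sqrt N"
      by (simp add: Y_def l_def scaleR_sum_right divide_inverse mult.commute)
    ultimately show False using nz[of l] that(1) by simp
  qed
  \<comment> \<open>The round equation at \<open>l\<close> is a vanishing combination of the
    \<open>X i\<close>; by \<open>inj\<close> each coefficient is zero, and \<open>l i\<close> can
    be cancelled where it is nonzero.\<close>
  have coeff: "h i \<bullet> X i = H l \<bullet> Y l"
    if l: "l \<in> topspace (nsphere p)" and i: "i \<le> p" "l i \<noteq> 0" for l i
  proof -
    have "(\<Sum>i\<le>p. (l i * (inverse (h i \<bullet> X i) - inverse (H l \<bullet> Y l))) *\<^sub>R X i) =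
        (\<Sum>i\<le>p. l i *\<^sub>R (X i /\<^sub>R (h i \<bullet> X i))) - Y l /\<^sub>R (H l \<bullet> Y l)"
      by (simp add: Y_def algebra_simps sum_subtractf scaleR_sum_right)
    also have "\<dots> = 0" using round l by simp
    finally have "l i * (inverse (h i \<bullet> X i) - inverse (H l \<bullet> Y l)) = 0"
      by (rule inj) (use i in simp)
    then show ?thesis using i by simp
  qed
  \<comment> \<open>All coordinates of \<open>u\<close> up to \<open>p\<close> are nonzero, so
    \<open>coeff\<close> links it to every generator. An arbitrary \<open>l\<close> has some nonzero
    coordinate i and is linked to \<open>u\<close> through \<open>h i \<bullet> X i\<close>.\<close>
  define u :: "nat \<Rightarrow> real" where "u j = (if j \<le> p then 1 / sqrt (real (Suc p)) else 0)" for j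
  have u: "u \<in> topspace (nsphere p)"
    by (simp add: nsphere_iff u_def power_divide)
  have "H l \<bullet> Y l = H u \<bullet> Y u" if l: "l \<in> topspace (nsphere p)" for l
  proof -
    obtain i where i: "i \<le> p" "l i \<noteq> 0"
      using l sum.not_neutral_contains_not_neutral[of "\<lambda>i. (l i)\<^sup>2" "{..p}"]
      by (auto simp: nsphere_iff)
    then show ?thesis using coeff[OF l i] coeff[OF u i(1)] by (simp add: u_def)
  qed
  then show ?taut by simp
qed

lemma taut_iff_coord:
  fixes M :: "('a, 3) manifold"
  assumes M: "smooth_manifold M" and "cosymplectic_sphere 1 M p \<eta> \<Omega>"
  shows "taut 1 M p \<eta> \<Omega> \<longleftrightarrow>
    (\<forall>c\<in>atlas M. \<forall>x\<in>fst c. \<forall>l\<in>topspace (nsphere p). \<forall>\<mu>\<in>topspace (nsphere p).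
      covec M c (comb_form p l \<eta>) (snd c x) \<bullet> bivec M c (comb_form p l \<Omega>) (snd c x) =
      covec M c (comb_form p \<mu> \<eta>) (snd c x) \<bullet> bivec M c (comb_form p \<mu> \<Omega>) (snd c x))"
    (is "_ \<longleftrightarrow> (\<forall>c\<in>atlas M. \<forall>x\<in>fst c. \<forall>l\<in>?S. \<forall>\<mu>\<in>?S. ?f c x l = ?f c x \<mu>)")
proof -
  let ?vol = "\<lambda>l. cosymplectic_volume 1 (comb_form p l \<eta>) (comb_form p l \<Omega>)"
  have cs: "cosymplectic 1 M (comb_form p l \<eta>) (comb_form p l \<Omega>)" if "l \<in> ?S" for l
    using assms(2) that by (simp add: cosymplectic_sphere_def)
  have vol: "?vol l x [u, v, w] = ?f c x l * (u c \<bullet> cross3 (v c) (w c))"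
    if "l \<in> ?S" "c \<in> atlas M" "x \<in> fst c"
      "u \<in> tangent_space M x" "v \<in> tangent_space M x" "w \<in> tangent_space M x" for l c x u v w
    using that by (intro cosymplectic_volume_eq M cosymplectic_imp_forms[OF cs])
  show ?thesis
  proof (intro iffI ballI)
    fix c x l \<mu>
    assume taut: "taut 1 M p \<eta> \<Omega>" and c: "c \<in> atlas M" "x \<in> fst c" and S: "l \<in> ?S" "\<mu> \<in> ?S"
    \<comment> \<open>On the coordinate frame the triple product is 1, so the volume form evaluates
      to the scalar factor itself.\<close>
    define E where "E i = coord_vec M c x (axis i 1)" for i
    note E = coord_vec_tangent[OF M c, of "axis _ 1", folded E_def]
    have "x \<in> topspace (mtop M)" using chart_subset[OF M c(1)] c(2) by blast
    moreover have "[E 1, E 2, E 3] \<in> tangent_tuples M (2 * 1 + 1) x"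
      using E by (simp add: tangent_tuples_def)
    ultimately have "?vol l x [E 1, E 2, E 3] = ?vol \<mu> x [E 1, E 2, E 3]"
      using taut S unfolding taut_def form_eq_def by blast
    moreover have "E 1 c \<bullet> cross3 (E 2 c) (E 3 c) = 1"
      by (simp add: E_def coord_vec_self[OF M c]) (simp add: cross3_simps axis_def)
    ultimately show "?f c x l = ?f c x \<mu>"
      using vol[OF S(1) c E E E] vol[OF S(2) c E E E] by simp
  next
    assume eq: "\<forall>c\<in>atlas M. \<forall>x\<in>fst c. \<forall>l\<in>?S. \<forall>\<mu>\<in>?S. ?f c x l = ?f c x \<mu>"
    show "taut 1 M p \<eta> \<Omega>"
      unfolding taut_def form_eq_def
    proof (intro ballI)
      fix l \<mu> x vs
      assume S: "l \<in> ?S" "\<mu> \<in> ?S" and x: "x \<in> topspace (mtop M)"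
        and vs: "vs \<in> tangent_tuples M (2 * 1 + 1) x"
      obtain c where c: "c \<in> atlas M" "x \<in> fst c" using topspace_in_chart[OF M x] .
      have "vs \<in> tangent_tuples M 3 x" using vs by simp
      then obtain u v w where "vs = [u, v, w]" and uvw: "u \<in> tangent_space M x"
          "v \<in> tangent_space M x" "w \<in> tangent_space M x"
        by (rule tangent_tuples_3E)
      moreover have "?f c x l = ?f c x \<mu>" using eq c S by blast
      ultimately show "?vol l x vs = ?vol \<mu> x vs"
        by (simp only: vol[OF S(1) c uvw] vol[OF S(2) c uvw])
    qed
  qed
qed

lemma round_iff_coord:
  fixes M :: "('a, 3) manifold"
  assumes M: "smooth_manifold M" and sphere: "cosymplectic_sphere 1 M p \<eta> \<Omega>"
  shows "round_sphere M p \<eta> \<Omega> \<longleftrightarrow>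
    (\<forall>c\<in>atlas M. \<forall>x\<in>fst c. \<forall>l\<in>topspace (nsphere p).
      (\<Sum>i\<le>p. l i *\<^sub>R reeb_coord M c (\<eta> i) (\<Omega> i) (snd c x)) =
      reeb_coord M c (comb_form p l \<eta>) (comb_form p l \<Omega>) (snd c x))"
proof -
  \<comment> \<open>Only the indices up to \<open>p\<close> enter the sum, and there the generators
    are cosymplectic, so \<open>reeb\<close> is the explicit field.\<close>
  have "comb_field p l (\<lambda>i. reeb M (\<eta> i) (\<Omega> i)) =
      comb_field p l (\<lambda>i. reeb_field M (\<eta> i) (\<Omega> i))" for l
    unfolding comb_field_def using sphere
    by (intro ext sum.cong refl) (simp add: cosymplectic_sphere_def reeb_eq_reeb_field[OF M])
  \<comment> \<open>By \<open>is_reeb_iff\<close> being the Reeb field is an equality of functions,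
    which also brings smoothness of the combination. Its components outside the charts are zero on
    both sides.\<close>
  then have "is_reeb M (comb_form p l \<eta>) (comb_form p l \<Omega>)
        (comb_field p l (\<lambda>i. reeb M (\<eta> i) (\<Omega> i))) \<longleftrightarrow>
      (\<forall>c\<in>atlas M. \<forall>x\<in>fst c. (\<Sum>i\<le>p. l i *\<^sub>R reeb_coord M c (\<eta> i) (\<Omega> i) (snd c x)) =
        reeb_coord M c (comb_form p l \<eta>) (comb_form p l \<Omega>) (snd c x))"
    if "l \<in> topspace (nsphere p)" for l
    using sphere that
    by (auto simp: cosymplectic_sphere_def is_reeb_iff[OF M] comb_field_def reeb_field_def fun_eq_iff)
  then show ?thesis unfolding round_sphere_def by blast
qed

theorem theorem3p3:
  fixes M :: "('a, 3) manifold"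
    and p :: nat
    and \<eta> \<Omega> :: "nat \<Rightarrow> ('a, 3) form"
  assumes "smooth_manifold M"
    and "p \<ge> 1"
    and "cosymplectic_sphere 1 M p \<eta> \<Omega>"
  shows "taut 1 M p \<eta> \<Omega> \<longleftrightarrow> round_sphere M p \<eta> \<Omega>"
proof -
  have nz: "(\<Sum>i\<le>p. l i *\<^sub>R covec M c (\<eta> i) (snd c x)) \<bullet>
      (\<Sum>i\<le>p. l i *\<^sub>R bivec M c (\<Omega> i) (snd c x)) \<noteq> 0"
    if "c \<in> atlas M" "x \<in> fst c" "l \<in> topspace (nsphere p)" for c x l
    using cosymplectic_nondegenerate[OF assms(1) that(1,2)] assms(3) that(3)
    by (simp add: cosymplectic_sphere_def flip: covec_comb_form bivec_comb_form)
  show ?thesis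
    \<comment> \<open>Both conditions now quantify over the same charts and points, and at each of
      them the claim is the linear algebra of \<open>taut_iff_round_pointwise\<close>.\<close>
    unfolding taut_iff_coord[OF assms(1,3)] round_iff_coord[OF assms(1,3)]
      reeb_coord_def covec_comb_form bivec_comb_form
    by (intro ball_cong refl taut_iff_round_pointwise nz)
qed

end
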